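(* Let $K\ge 2$ and let $\bm p$ be a strictly positive probability distribution on triples $(a,x,y)\in\{1,\dots,K\}^3$. Let $\bm p^*$ be obtained from $\bm p$ by an intervention on the bias $A$, i.e. for some strictly positive distribution $\bm p^*(a)$ on $\{1,\dots,K\}$ with score vector $\mathbf s_A^*$, $$\bm p^*(a,x,y)=\bm p^*(a)\,\bm p(x\mid a)\,\bm p(y\mid a,x)\qquad\text{for all }a,x,y.$$ Let $\delta_{\text{causal}}=\|\theta_\rightarrow^{(0)}-\theta_\rightarrow^*\|^2$ and $\delta_{\text{anticausal}}=\|\theta_\leftarrow^{(0)}-\theta_\leftarrow^*\|^2$ be the squared distances between the parameters of $\bm p$ and of $\bm p^*$ in the causal and anti-causal parametrizations. Then $$\delta_{\text{causal}}=\delta_{\text{anticausal}}=\|\mathbf s_A-\mathbf s_A^*\|^2.$$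
   Context: $A$ (bias / sensitive variable), $X$ (cause), $Y$ (effect) are categorical variables with values in $\{1,\dots,K\}$. Scores: a strictly positive distribution $(p_z)_{z=1}^K$ is represented by its score vector $\mathbf s=(s_z)_{z=1}^K\in\mathbb R^K$ with $p_z=e^{s_z}/\sum_{z'}e^{s_{z'}}$, normalized by $\sum_z s_z=0$ (so the score vector is uniquely determined by the distribution). For a joint distribution $\bm p(a,x,y)$ write $\mathbf s_A=(s_a)_a$ for the score of the marginal $\bm p(a)$; $\mathbf s_{X|a}=(s_{x|a})_x$ for the score of $\bm p(x\mid a)$; $\mathbf s_{Y|a}=(s_{y|a})_y$ for the score of $\bm p(y\mid a)$; $\mathbf s_{Y|a,x}=(s_{y|a,x})_y$ for the score of $\bm p(y\mid a,x)$; $\mathbf s_{X|a,y}=(s_{x|a,y})_x$ for the score of $\bm p(x\mid a,y)$. Each of these vectors sums to zero. Starred quantities are the corresponding scores of $\bm p^*$. Causal parametrization (factorization $\bm p(a)\bm p(x|a)\bm p(y|a,x)$): $\theta_\rightarrow=(\mathbf s_A,(\mathbf s_{X|a})_a,(\mathbf s_{Y|a,x})_{a,x})$. Anti-causal parametrization (factorization $\bm p(a)\bm p(y|a)\bm p(x|a,y)$): $\theta_\leftarrow=(\mathbf s_A,(\mathbf s_{Y|a})_a,(\mathbf s_{X|a,y})_{a,y})$. The superscript $(0)$ denotes the parameters of $\bm p$ and the superscript $*$ those of $\bm p^*$. Norms are Euclidean norms over all coordinates, so that $$\delta_{\text{causal}}=\|\mathbf s_A-\mathbf s_A^*\|^2+\sum_a\|\mathbf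 s_{X|a}-\mathbf s^*_{X|a}\|^2+\sum_{a,x}\|\mathbf s_{Y|a,x}-\mathbf s^*_{Y|a,x}\|^2,$$ $$\delta_{\text{anticausal}}=\|\mathbf s_A-\mathbf s_A^*\|^2+\sum_a\|\mathbf s_{Y|a}-\mathbf s^*_{Y|a}\|^2+\sum_{a,y}\|\mathbf s_{X|a,y}-\mathbf s^*_{X|a,y}\|^2.$$ *)

theory Defs
  imports "HOL-Analysis.Analysis"
begin

text \<open>
  The category set \<open>{1,\<dots>,K}\<close> is a finite type \<open>'k\<close> with \<open>CARD('k) = K\<close>. A distribution on it is
  given by its mass function, and a joint distribution of \<open>(A, X, Y)\<close> by a curried mass function
  \<open>p a x y\<close>.
\<close>

definition pos_dist :: "('k::finite \<Rightarrow> real) \<Rightarrow> bool" where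
  "pos_dist q \<longleftrightarrow> (\<forall>z. q z > 0) \<and> (\<Sum>z\<in>UNIV. q z) = 1"

definition pos_joint_dist :: "('k::finite \<Rightarrow> 'k \<Rightarrow> 'k \<Rightarrow> real) \<Rightarrow> bool" where
  "pos_joint_dist p \<longleftrightarrow>
     (\<forall>a x y. p a x y > 0) \<and> (\<Sum>a\<in>UNIV. \<Sum>x\<in>UNIV. \<Sum>y\<in>UNIV. p a x y) = 1"

subsection \<open>Scores\<close>

definition is_score :: "('k::finite \<Rightarrow> real) \<Rightarrow> real ^ 'k \<Rightarrow> bool" where
  "is_score q s \<longleftrightarrow>
     (\<forall>z. q z = exp (s $ z) / (\<Sum>z'\<in>UNIV. exp (s $ z'))) \<and> (\<Sum>z\<in>UNIV. s $ z) = 0"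

definition score :: "('k::finite \<Rightarrow> real) \<Rightarrow> real ^ 'k" where
  "score q = (THE s. is_score q s)"

text \<open>The description is proper for every strictly positive distribution.\<close>

lemma is_score_unique:
  fixes s t :: "real ^ 'k::finite"
  assumes "is_score q s" "is_score q t"
  shows "s = t"
proof -
  define S where "S = (\<Sum>z\<in>UNIV. exp (s $ z))"
  define T where "T = (\<Sum>z\<in>UNIV. exp (t $ z))"
  have pos: "S > 0" "T > 0"
    unfolding S_def T_def by (simp_all add: sum_pos)
  have d: "s $ z = t $ z + (ln S - ln T)" for z
  proof -
    have "exp (s $ z) / S = exp (t $ z) / T"
      using assms unfolding is_score_def S_def T_def by metis
    then have "ln (exp (s $ z) / S) = ln (exp (t $ z) / T)"
      by simp
    with pos show ?thesis
      by (simp add: ln_div)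
  qed
  have "(\<Sum>z\<in>UNIV. s $ z) = (\<Sum>z\<in>UNIV. t $ z) + real CARD('k) * (ln S - ln T)"
    by (simp add: d sum.distrib)
  then have "ln S - ln T = 0"
    using assms by (simp add: is_score_def)
  with d show ?thesis
    by (simp add: vec_eq_iff)
qed

lemma is_score_score:
  fixes q :: "'k::finite \<Rightarrow> real"
  assumes "pos_dist q"
  shows "is_score q (score q)"
proof -
  define c where "c = (\<Sum>z\<in>UNIV. ln (q z)) / real CARD('k)"
  define s :: "real ^ 'k" where "s = (\<chi> z. ln (q z) - c)"
  have q: "q z > 0" "(\<Sum>z\<in>UNIV. q z) = 1" for z
    using assms by (auto simp: pos_dist_def)
  have e: "exp (s $ z) = q z / exp c" for z
    using q by (simp add: s_def exp_diff)
  have "(\<Sum>z\<in>UNIV. exp (s $ z)) = 1 / exp c"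
    using q by (simp add: e flip: sum_divide_distrib)
  moreover have "(\<Sum>z\<in>UNIV. s $ z) = 0"
    by (simp add: s_def sum_subtractf c_def)
  ultimately have "is_score q s"
    by (simp add: is_score_def e)
  then show ?thesis
    unfolding score_def by (rule theI) (rule is_score_unique[OF _ \<open>is_score q s\<close>])
qed

subsection \<open>Marginals and conditionals\<close>

definition marg_A :: "('k::finite \<Rightarrow> 'k \<Rightarrow> 'k \<Rightarrow> real) \<Rightarrow> 'k \<Rightarrow> real" where
  "marg_A p a = (\<Sum>x\<in>UNIV. \<Sum>y\<in>UNIV. p a x y)"

definition marg_AX :: "('k::finite \<Rightarrow> 'k \<Rightarrow> 'k \<Rightarrow> real) \<Rightarrow> 'k \<Rightarrow> 'k \<Rightarrow> real" where
  "marg_AX p a x = (\<Sum>y\<in>UNIV. p a x y)"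

definition marg_AY :: "('k::finite \<Rightarrow> 'k \<Rightarrow> 'k \<Rightarrow> real) \<Rightarrow> 'k \<Rightarrow> 'k \<Rightarrow> real" where
  "marg_AY p a y = (\<Sum>x\<in>UNIV. p a x y)"

text \<open>In each conditional the conditioning values come first and the distributed value last.\<close>

definition cond_X_A :: "('k::finite \<Rightarrow> 'k \<Rightarrow> 'k \<Rightarrow> real) \<Rightarrow> 'k \<Rightarrow> 'k \<Rightarrow> real" where
  "cond_X_A p a x = marg_AX p a x / marg_A p a"

definition cond_Y_A :: "('k::finite \<Rightarrow> 'k \<Rightarrow> 'k \<Rightarrow> real) \<Rightarrow> 'k \<Rightarrow> 'k \<Rightarrow> real" where
  "cond_Y_A p a y = marg_AY p a y / marg_A p a"

definition cond_Y_AX :: "('k::finite \<Rightarrow> 'k \<Rightarrow> 'k \<Rightarrow> real) \<Rightarrow> 'k \<Rightarrow> 'k \<Rightarrow> 'k \<Rightarrow> real" where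
  "cond_Y_AX p a x y = p a x y / marg_AX p a x"

definition cond_X_AY :: "('k::finite \<Rightarrow> 'k \<Rightarrow> 'k \<Rightarrow> real) \<Rightarrow> 'k \<Rightarrow> 'k \<Rightarrow> 'k \<Rightarrow> real" where
  "cond_X_AY p a y x = p a x y / marg_AY p a y"

subsection \<open>Parametrizations\<close>

text \<open>
  Both parameter spaces are nested Euclidean spaces; the library norms on products and on finite
  Cartesian powers are \<open>\<ell>\<^sup>2\<close> norms, so the norm of a parameter is the Euclidean norm over all
  coordinates.
\<close>

type_synonym 'k params = "(real ^ 'k) \<times> (real ^ 'k ^ 'k) \<times> (real ^ 'k ^ 'k ^ 'k)"

definition theta_causal :: "('k::finite \<Rightarrow> 'k \<Rightarrow> 'k \<Rightarrow> real) \<Rightarrow> 'k params" where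
  "theta_causal p =
     (score (marg_A p),
      \<chi> a. score (cond_X_A p a),
      \<chi> a x. score (cond_Y_AX p a x))"

definition theta_anticausal :: "('k::finite \<Rightarrow> 'k \<Rightarrow> 'k \<Rightarrow> real) \<Rightarrow> 'k params" where
  "theta_anticausal p =
     (score (marg_A p),
      \<chi> a. score (cond_Y_A p a),
      \<chi> a y. score (cond_X_AY p a y))"

definition delta_causal ::
    "('k::finite \<Rightarrow> 'k \<Rightarrow> 'k \<Rightarrow> real) \<Rightarrow> ('k \<Rightarrow> 'k \<Rightarrow> 'k \<Rightarrow> real) \<Rightarrow> real" where
  "delta_causal p p' = (norm (theta_causal p - theta_causal p'))\<^sup>2"

definition delta_anticausal ::
    "('k::finite \<Rightarrow> 'k \<Rightarrow> 'k \<Rightarrow> real) \<Rightarrow> ('k \<Rightarrow> 'k \<Rightarrow> 'k \<Rightarrow> real) \<Rightarrow> real" where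
  "delta_anticausal p p' = (norm (theta_anticausal p - theta_anticausal p'))\<^sup>2"

lemma norm_vec_squared:
  fixes v :: "('b::real_normed_vector) ^ 'k::finite"
  shows "(norm v)\<^sup>2 = (\<Sum>i\<in>UNIV. (norm (v $ i))\<^sup>2)"
  by (simp add: norm_vec_def L2_set_def sum_nonneg)

lemma norm_Pair_squared: "(norm (u, v))\<^sup>2 = (norm u)\<^sup>2 + (norm v)\<^sup>2"
  by (simp add: norm_Pair)

lemma delta_causal_expand:
  "delta_causal p p' =
     (norm (score (marg_A p) - score (marg_A p')))\<^sup>2
     + (\<Sum>a\<in>UNIV. (norm (score (cond_X_A p a) - score (cond_X_A p' a)))\<^sup>2)
     + (\<Sum>a\<in>UNIV. \<Sum>x\<in>UNIV. (norm (score (cond_Y_AX p a x) - score (cond_Y_AX p' a x)))\<^sup>2)"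
  by (simp add: delta_causal_def theta_causal_def norm_Pair_squared norm_vec_squared)

lemma delta_anticausal_expand:
  "delta_anticausal p p' =
     (norm (score (marg_A p) - score (marg_A p')))\<^sup>2
     + (\<Sum>a\<in>UNIV. (norm (score (cond_Y_A p a) - score (cond_Y_A p' a)))\<^sup>2)
     + (\<Sum>a\<in>UNIV. \<Sum>y\<in>UNIV. (norm (score (cond_X_AY p a y) - score (cond_X_AY p' a y)))\<^sup>2)"
  by (simp add: delta_anticausal_def theta_anticausal_def norm_Pair_squared norm_vec_squared)

end

(* The factorization gives p* (a,x,y) = (p* (a) / p(a)) p(a,x,y): the intervention rescales each
   slice of p at fixed a, so every conditional given a, in either factorization, is unchanged and
   only the marginal of A moves. *)
theory Submission
  imports Defs
begin

lemma
  fixes p :: "'k::finite \<Rightarrow> 'k \<Rightarrow> 'k \<Rightarrow> real"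
  shows marg_A_rescale: "marg_A (\<lambda>a x y. c a * p a x y) a = c a * marg_A p a"
    and marg_AX_rescale: "marg_AX (\<lambda>a x y. c a * p a x y) a x = c a * marg_AX p a x"
    and marg_AY_rescale: "marg_AY (\<lambda>a x y. c a * p a x y) a y = c a * marg_AY p a y"
  by (simp_all add: marg_A_def marg_AX_def marg_AY_def sum_distrib_left)

text \<open>Each conditional is a quotient of two masses in the same slice \<open>a\<close>. Since
  \<open>c\<close> depends on neither \<open>x\<close> nor \<open>y\<close>, both masses carry the
  factor \<open>c a\<close>, which cancels as it is nonzero.\<close>

lemma
  fixes p :: "'k::finite \<Rightarrow> 'k \<Rightarrow> 'k \<Rightarrow> real"
  assumes "\<And>a. c a \<noteq> 0"
  shows cond_X_A_rescale: "cond_X_A (\<lambda>a x y. c a * p a x y) = cond_X_A p"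
    and cond_Y_A_rescale: "cond_Y_A (\<lambda>a x y. c a * p a x y) = cond_Y_A p"
    and cond_Y_AX_rescale: "cond_Y_AX (\<lambda>a x y. c a * p a x y) = cond_Y_AX p"
    and cond_X_AY_rescale: "cond_X_AY (\<lambda>a x y. c a * p a x y) = cond_X_AY p"
  using assms
  by (simp_all add: fun_eq_iff cond_X_A_def cond_Y_A_def cond_Y_AX_def cond_X_AY_def
      marg_A_rescale marg_AX_rescale marg_AY_rescale)

lemma
  fixes p :: "'k::finite \<Rightarrow> 'k \<Rightarrow> 'k \<Rightarrow> real"
  assumes "pos_joint_dist p"
  shows marg_A_pos: "marg_A p a > 0"
    and marg_AX_pos: "marg_AX p a x > 0"
  using assms by (auto simp: pos_joint_dist_def marg_A_def marg_AX_def intro!: sum_pos)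

theorem mainTheorem4:
  fixes p p_star :: "'k::finite \<Rightarrow> 'k \<Rightarrow> 'k \<Rightarrow> real"
    and pA_star :: "'k \<Rightarrow> real"
  assumes "CARD('k) \<ge> 2"
    and "pos_joint_dist p"
    and "pos_dist pA_star"
    and "\<And>a x y. p_star a x y = pA_star a * cond_X_A p a x * cond_Y_AX p a x y"
  shows "delta_causal p p_star = delta_anticausal p p_star
       \<and> delta_anticausal p p_star = (norm (score (marg_A p) - score pA_star))\<^sup>2"
proof -
  \<comment> \<open>The ratio of the new to the old marginal of A.\<close>
  define c where "c a = pA_star a / marg_A p a" for a
  have pos: "marg_A p a \<noteq> 0" "marg_AX p a x \<noteq> 0" for a x
    using marg_A_pos[OF assms(2)] marg_AX_pos[OF assms(2)] by (simp_all add: less_imp_neq[symmetric])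
  have "pA_star a \<noteq> 0" for a
    using assms(3) by (simp add: pos_dist_def less_imp_neq[symmetric])
  then have c: "c a \<noteq> 0" for a
    by (simp add: c_def pos)
  \<comment> \<open>The two causal conditionals telescope: \<open>marg_AX p a x\<close> cancels,
    leaving \<open>p a x y / marg_A p a\<close>.\<close>
  have p_star: "p_star = (\<lambda>a x y. c a * p a x y)"
    by (simp add: fun_eq_iff assms(4) c_def cond_X_A_def cond_Y_AX_def pos)
  have "marg_A p_star = pA_star"
    unfolding p_star fun_eq_iff marg_A_rescale by (simp add: c_def pos)
  moreover have "cond_X_A p_star = cond_X_A p" "cond_Y_A p_star = cond_Y_A p"
      "cond_Y_AX p_star = cond_Y_AX p" "cond_X_AY p_star = cond_X_AY p"
    unfolding p_star
    using c by (rule cond_X_A_rescale cond_Y_A_rescale cond_Y_AX_rescale cond_X_AY_rescale)+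
  \<comment> \<open>In both expansions the sums over conditional scores vanish term by term, so only
    the common A term remains.\<close>
  ultimately show ?thesis
    by (simp add: delta_causal_expand delta_anticausal_expand)
qed

end
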